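(* Let $(M,\mathcal{T})$, $\mathcal{T}=(V,E,F)$, be an infinitely triangulated surface with a PH metric $d_0$ and with vertex degrees uniformly bounded by a constant $D$. Let $u(t),v(t)$, $t\ge0$, be two solutions to the extended hyperbolic combinatorial Yamabe flow $$\frac{du_i}{dt}=-\widetilde K_i(u(t))\qquad(i\in V,\ t\ge0)$$ satisfying $u(0)=v(0)$ and $$u-v\in L^1([0,T);\ell^1(V))\quad\text{for all }T>0.$$ Then $u(t)\equiv v(t)$ for all $t\ge0$.
   Context: Infinitely triangulated surface: $M$ is a surface and $\mathcal{T}=(V,E,F)$ is a locally finite triangulation of $M$ without boundary, with vertex set $V$ infinite (countable, vertices labelled by natural numbers), edge set $E$ and face set $F$. An edge is written $\{ij\}$, a face $\triangle ijk$; the degree of $i$ is the number of edges incident to $i$. PH (piecewise hyperbolic) metric: a function $d:E\to(0,\infty)$ such that for each face $\triangle ijk\in F$ the numbers $d_{ij},d_{ik},d_{jk}$ satisfy the strict triangle inequalities, so that they are the side lengths of a nondegenerate hyperbolic triangle (curvature $-1$). Hyperbolic vertex scaling: for $u:V\to\mathbb{R}$, $u*d_0:E\to(0,\infty)$ is defined by $\sinh\frac{(u*d_0)_{ij}}{2}=e^{\frac{u_i+u_j}{2}}\sinh\frac{(d_0)_{ij}}{2}$. Extended angles: for $u:V\to\mathbb{R}$, a face $\triangle ijk\in F$ and $d=u*d_0$, set $\widetilde\theta_i^{jk}(u)$ to be the interior angle at $i$ of the hyperbolic triangle with side lengths $d_{ij},d_{ik},d_{jk}$ if these satisfy the strict triangle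 inequalities; $\widetilde\theta_i^{jk}(u)=\pi$ if $d_{jk}\ge d_{ij}+d_{ik}$; and $\widetilde\theta_i^{jk}(u)=0$ if $d_{ik}\ge d_{ij}+d_{jk}$ or $d_{ij}\ge d_{ik}+d_{jk}$. (At most one triangle inequality can fail, and $\widetilde\theta_i^{jk}$ is a continuous function of $(u_i,u_j,u_k)\in\mathbb{R}^3$.) The generalized combinatorial curvature, defined for every $u:V\to\mathbb{R}$, is $\widetilde K_i(u)=2\pi-\sum_{\triangle ijk\in F}\widetilde\theta_i^{jk}(u)$ (sum over faces containing $i$). A solution is a function $u:V\times[0,\infty)\to\mathbb{R}$ with each $t\mapsto u_i(t)$ of class $C^1$ satisfying the equations. Here $\|w\|_{\ell^1(V)}=\sum_{i\in V}|w_i|$, and $L^1([0,T);\ell^1(V))$ is the space of functions $f:[0,T)\times V\to\mathbb{R}$ with $\int_0^T\|f(t,\cdot)\|_{\ell^1(V)}\,dt<\infty$. *)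

theory Defs
  imports "HOL-Analysis.Analysis"
begin

definition topological_surface :: "'a topology \<Rightarrow> bool" where
  "topological_surface M \<longleftrightarrow>
     Hausdorff_space M \<and> second_countable M \<and>
     (\<forall>x\<in>topspace M. \<exists>U W. openin M U \<and> x \<in> U \<and> open (W :: (real^2) set) \<and>
        subtopology M U homeomorphic_space top_of_set W)"

text \<open>
  The closed simplex spanned by a finite vertex set, in barycentric coordinates. The type
  \<^typ>\<open>nat \<Rightarrow> real\<close> carries the product topology, which on a simplex is the Euclidean one.
\<close>

definition closed_simplex :: "nat set \<Rightarrow> (nat \<Rightarrow> real) set" where
  "closed_simplex s = {x. (\<forall>i. 0 \<le> x i) \<and> (\<forall>i. i \<notin> s \<longrightarrow> x i = 0) \<and> (\<Sum>i\<in>s. x i) = 1}"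

text \<open>Geometric realization of a family of simplices, with the weak (coherent) topology.\<close>

definition realization :: "nat set set \<Rightarrow> (nat \<Rightarrow> real) topology" where
  "realization K = topology (\<lambda>U. U \<subseteq> (\<Union>s\<in>K. closed_simplex s) \<and>
     (\<forall>s\<in>K. openin (top_of_set (closed_simplex s)) (U \<inter> closed_simplex s)))"

lemma openin_realization:
  "openin (realization K) U \<longleftrightarrow> U \<subseteq> (\<Union>s\<in>K. closed_simplex s) \<and>
     (\<forall>s\<in>K. openin (top_of_set (closed_simplex s)) (U \<inter> closed_simplex s))"
proof -
  have "istopology (\<lambda>U. U \<subseteq> (\<Union>s\<in>K. closed_simplex s) \<and>
     (\<forall>s\<in>K. openin (top_of_set (closed_simplex s)) (U \<inter> closed_simplex s)))"
    unfolding istopology_def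
  proof (intro conjI allI impI ballI)
    fix S T s
    assume S: "S \<subseteq> (\<Union>s\<in>K. closed_simplex s) \<and>
        (\<forall>s\<in>K. openin (top_of_set (closed_simplex s)) (S \<inter> closed_simplex s))"
      and T: "T \<subseteq> (\<Union>s\<in>K. closed_simplex s) \<and>
        (\<forall>s\<in>K. openin (top_of_set (closed_simplex s)) (T \<inter> closed_simplex s))"
    show "S \<inter> T \<subseteq> (\<Union>s\<in>K. closed_simplex s)"
      using S by blast
    assume "s \<in> K"
    then have "openin (top_of_set (closed_simplex s)) (S \<inter> closed_simplex s)"
      and "openin (top_of_set (closed_simplex s)) (T \<inter> closed_simplex s)"
      using S T by blast+
    then have "openin (top_of_set (closed_simplex s))
        ((S \<inter> closed_simplex s) \<inter> (T \<inter> closed_simplex s))"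
      by (rule openin_Int)
    moreover have "(S \<inter> closed_simplex s) \<inter> (T \<inter> closed_simplex s) = S \<inter> T \<inter> closed_simplex s"
      by blast
    ultimately show "openin (top_of_set (closed_simplex s)) (S \<inter> T \<inter> closed_simplex s)"
      by simp
  next
    fix \<U> s
    assume U: "\<forall>S\<in>\<U>. S \<subseteq> (\<Union>s\<in>K. closed_simplex s) \<and>
        (\<forall>s\<in>K. openin (top_of_set (closed_simplex s)) (S \<inter> closed_simplex s))"
    show "\<Union>\<U> \<subseteq> (\<Union>s\<in>K. closed_simplex s)"
      using U by blast
    assume "s \<in> K"
    then have "openin (top_of_set (closed_simplex s)) (\<Union>S\<in>\<U>. S \<inter> closed_simplex s)"
      using U by (intro openin_Union) blast
    moreover have "(\<Union>S\<in>\<U>. S \<inter> closed_simplex s) = \<Union>\<U> \<inter> closed_simplex s"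
      by blast
    ultimately show "openin (top_of_set (closed_simplex s)) (\<Union>\<U> \<inter> closed_simplex s)"
      by simp
  qed
  then show ?thesis
    by (simp add: realization_def topology_inverse')
qed

text \<open>
  Edges and faces are identified with their vertex sets. Manifolds here are
  boundaryless (charts are modelled on open subsets of the plane), so requiring the realization
  to be homeomorphic to a surface excludes boundary edges, dangling edges and isolated vertices.
  Connectedness is not required.
\<close>

definition infinitely_triangulated_surface ::
    "'a topology \<Rightarrow> nat set \<Rightarrow> nat set set \<Rightarrow> nat set set \<Rightarrow> bool" where
  "infinitely_triangulated_surface M V E F \<longleftrightarrow>
     topological_surface M \<and> infinite V \<and>
     (\<forall>e\<in>E. e \<subseteq> V \<and> card e = 2) \<and>
     (\<forall>f\<in>F. f \<subseteq> V \<and> card f = 3) \<and>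
     (\<forall>f\<in>F. \<forall>e. e \<subseteq> f \<and> card e = 2 \<longrightarrow> e \<in> E) \<and>
     (\<forall>i\<in>V. finite {s \<in> E \<union> F. i \<in> s}) \<and>
     realization ((\<lambda>i. {i}) ` V \<union> E \<union> F) homeomorphic_space M"

definition vertex_degree :: "nat set set \<Rightarrow> nat \<Rightarrow> nat" where
  "vertex_degree E i = card {e \<in> E. i \<in> e}"

text \<open>
  The hyperboloid model of the hyperbolic plane of curvature -1. The first component is the time
  coordinate; the second one is the Euclidean plane, written as the complex numbers.
\<close>

definition mink :: "real \<times> complex \<Rightarrow> real \<times> complex \<Rightarrow> real" where
  "mink p q = snd p \<bullet> snd q - fst p * fst q"

definition hyp_plane :: "(real \<times> complex) set" where
  "hyp_plane = {p. mink p p = -1 \<and> fst p > 0}"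

definition hyp_dist :: "real \<times> complex \<Rightarrow> real \<times> complex \<Rightarrow> real" where
  "hyp_dist p q = arcosh (- mink p q)"

text \<open>
  The initial direction at p of the geodesic from p to q: the Minkowski-orthogonal projection of
  q to the tangent space of the hyperboloid at p.
\<close>

definition hyp_dir :: "real \<times> complex \<Rightarrow> real \<times> complex \<Rightarrow> real \<times> complex" where
  "hyp_dir p q = q + mink p q *\<^sub>R p"

definition hyp_angle :: "real \<times> complex \<Rightarrow> real \<times> complex \<Rightarrow> real \<times> complex \<Rightarrow> real" where
  "hyp_angle p q r =
     arccos (mink (hyp_dir p q) (hyp_dir p r) /
       (sqrt (mink (hyp_dir p q) (hyp_dir p q)) * sqrt (mink (hyp_dir p r) (hyp_dir p r))))"

definition strict_triangle :: "real \<Rightarrow> real \<Rightarrow> real \<Rightarrow> bool" where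
  "strict_triangle a b c \<longleftrightarrow> a < b + c \<and> b < a + c \<and> c < a + b"

text \<open>
  The interior angle opposite to the side of length a in the hyperbolic triangle with side
  lengths a, b, c.
\<close>

definition interior_angle :: "real \<Rightarrow> real \<Rightarrow> real \<Rightarrow> real" where
  "interior_angle a b c = (THE \<theta>. \<exists>p\<in>hyp_plane. \<exists>q\<in>hyp_plane. \<exists>r\<in>hyp_plane.
     hyp_dist q r = a \<and> hyp_dist p q = b \<and> hyp_dist p r = c \<and> \<theta> = hyp_angle p q r)"

lemma mink_hyp_plane_le:
  assumes "p \<in> hyp_plane" "q \<in> hyp_plane"
  shows "1 \<le> - mink p q"
proof -
  obtain s P where p: "p = (s, P)" by (cases p)
  obtain t Q where q: "q = (t, Q)" by (cases q)
  have s: "s\<^sup>2 = 1 + (norm P)\<^sup>2" "s > 0" and t: "t\<^sup>2 = 1 + (norm Q)\<^sup>2" "t > 0"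
    using assms by (auto simp: p q hyp_plane_def mink_def dot_square_norm power2_eq_square)
  have "(s * t)\<^sup>2 = (1 + norm P * norm Q)\<^sup>2 + (norm P - norm Q)\<^sup>2"
    by (simp add: power_mult_distrib s t) (simp add: power2_eq_square algebra_simps)
  then have "(1 + norm P * norm Q)\<^sup>2 \<le> (s * t)\<^sup>2"
    using zero_le_power2[of "norm P - norm Q"] by linarith
  then have "1 + norm P * norm Q \<le> s * t"
    by (rule power2_le_imp_le) (use s(2) t(2) in simp)
  moreover have "P \<bullet> Q \<le> norm P * norm Q"
    by (rule norm_cauchy_schwarz)
  ultimately show ?thesis
    by (simp add: p q mink_def)
qed

lemma hyp_angle_eq:
  assumes "p \<in> hyp_plane" "q \<in> hyp_plane" "r \<in> hyp_plane"
    and "hyp_dist q r = a" "hyp_dist p q = b" "hyp_dist p r = c" "0 < b" "0 < c"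
  shows "hyp_angle p q r = arccos ((cosh b * cosh c - cosh a) / (sinh b * sinh c))"
proof -
  have m: "mink q r = - cosh a" "mink p q = - cosh b" "mink p r = - cosh c"
    using assms mink_hyp_plane_le[of q r] mink_hyp_plane_le[of p q] mink_hyp_plane_le[of p r]
    by (auto simp: hyp_dist_def)
  have one: "mink p p = -1" "mink q q = -1" "mink r r = -1"
    using assms by (auto simp: hyp_plane_def)
  have dir: "mink (hyp_dir p x) (hyp_dir p y) = mink x y + mink p x * mink p y" for x y
  proof -
    have "mink (hyp_dir p x) (hyp_dir p y) =
        mink x y + 2 * mink p x * mink p y + mink p x * mink p y * mink p p"
      by (simp add: hyp_dir_def mink_def inner_add_left inner_add_right inner_commute
          algebra_simps)
    then show ?thesis by (simp add: one)
  qed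
  have norm: "sqrt (- 1 + cosh x * cosh x) = sinh x" if "0 < x" for x :: real
  proof -
    have "- 1 + cosh x * cosh x = (sinh x)\<^sup>2"
      using cosh_square_eq[of x] by (simp add: power2_eq_square)
    then show ?thesis using that by simp
  qed
  have "mink (hyp_dir p q) (hyp_dir p r) = cosh b * cosh c - cosh a"
    "mink (hyp_dir p q) (hyp_dir p q) = - 1 + cosh b * cosh b"
    "mink (hyp_dir p r) (hyp_dir p r) = - 1 + cosh c * cosh c"
    by (simp_all add: dir m one)
  then show ?thesis
    using assms(7,8) by (simp only: hyp_angle_def norm)
qed

text \<open>Law of cosines; in particular, the angle is well defined.\<close>

lemma interior_angle_eq:
  assumes "0 < a" "0 < b" "0 < c" "strict_triangle a b c"
  shows "interior_angle a b c = arccos ((cosh b * cosh c - cosh a) / (sinh b * sinh c))"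
proof -
  define k where "k = (cosh b * cosh c - cosh a) / (sinh b * sinh c)"
  have pos: "sinh b * sinh c > 0" using assms by simp
  have sc: "k * (sinh b * sinh c) = cosh b * cosh c - cosh a"
    using assms by (simp add: k_def)
  have "cosh a \<le> cosh (b + c)"
    using assms by (subst cosh_real_nonneg_le_iff) (auto simp: strict_triangle_def)
  then have "(-1) * (sinh b * sinh c) \<le> k * (sinh b * sinh c)"
    by (simp add: sc cosh_add)
  then have k1: "-1 \<le> k" using pos by (simp only: mult_le_cancel_right_pos)
  have "cosh (b - c) = cosh \<bar>b - c\<bar>"
    by (simp add: cosh_real_abs)
  also have "\<dots> \<le> cosh a"
    using assms by (subst cosh_real_nonneg_le_iff) (auto simp: strict_triangle_def)
  finally have "k * (sinh b * sinh c) \<le> 1 * (sinh b * sinh c)"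
    by (simp add: sc cosh_diff)
  then have k2: "k \<le> 1" using pos by (simp only: mult_le_cancel_right_pos)
  define l where "l = sqrt (1 - k\<^sup>2)"
  have "k\<^sup>2 \<le> 1" using k1 k2 by (simp add: abs_square_le_1)
  then have l: "l\<^sup>2 = 1 - k\<^sup>2" by (simp add: l_def)
  define p q r where "p = (1::real, 0::complex)" and "q = (cosh b, Complex (sinh b) 0)"
    and "r = (cosh c, Complex (sinh c * k) (sinh c * l))"
  have "(sinh c * k)\<^sup>2 + (sinh c * l)\<^sup>2 = (sinh c)\<^sup>2"
    by (simp add: power_mult_distrib l algebra_simps)
  then have "sinh c * k * (sinh c * k) + sinh c * l * (sinh c * l) = cosh c * cosh c - 1"
    using cosh_square_eq[of c] by (simp only: power2_eq_square)
  moreover have "sinh b * sinh b = cosh b * cosh b - 1"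
    using cosh_square_eq[of b] by (simp add: power2_eq_square)
  ultimately have "p \<in> hyp_plane" "q \<in> hyp_plane" "r \<in> hyp_plane"
    by (simp_all add: p_def q_def r_def hyp_plane_def mink_def inner_complex_def)
  moreover have "- mink q r = cosh a" "- mink p q = cosh b" "- mink p r = cosh c"
    using sc by (simp_all add: p_def q_def r_def mink_def inner_complex_def algebra_simps)
  then have "hyp_dist q r = a" "hyp_dist p q = b" "hyp_dist p r = c"
    using assms by (simp_all add: hyp_dist_def arcosh_cosh_real)
  moreover from calculation have "arccos k = hyp_angle p q r"
    using hyp_angle_eq[of p q r a b c] assms by (simp add: k_def)
  ultimately have ex: "\<exists>p\<in>hyp_plane. \<exists>q\<in>hyp_plane. \<exists>r\<in>hyp_plane. hyp_dist q r = a \<and>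
      hyp_dist p q = b \<and> hyp_dist p r = c \<and> arccos k = hyp_angle p q r"
    by blast
  show ?thesis
    unfolding interior_angle_def k_def[symmetric]
  proof (rule the_equality)
    fix \<theta>
    assume "\<exists>p\<in>hyp_plane. \<exists>q\<in>hyp_plane. \<exists>r\<in>hyp_plane. hyp_dist q r = a \<and>
      hyp_dist p q = b \<and> hyp_dist p r = c \<and> \<theta> = hyp_angle p q r"
    then obtain p q r where "p \<in> hyp_plane" "q \<in> hyp_plane" "r \<in> hyp_plane"
      "hyp_dist q r = a" "hyp_dist p q = b" "hyp_dist p r = c" and \<theta>: "\<theta> = hyp_angle p q r"
      by blast
    then have "hyp_angle p q r = arccos k"
      unfolding k_def using assms(2,3) by (intro hyp_angle_eq)
    then show "\<theta> = arccos k"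
      by (simp add: \<theta>)
  qed (rule ex)
qed

definition PH_metric :: "nat set set \<Rightarrow> nat set set \<Rightarrow> (nat set \<Rightarrow> real) \<Rightarrow> bool" where
  "PH_metric E F d \<longleftrightarrow> (\<forall>e\<in>E. 0 < d e) \<and>
     (\<forall>i j k. {i, j, k} \<in> F \<longrightarrow> strict_triangle (d {i, j}) (d {i, k}) (d {j, k}))"

definition vertex_scaling :: "(nat \<Rightarrow> real) \<Rightarrow> (nat set \<Rightarrow> real) \<Rightarrow> nat set \<Rightarrow> real" where
  "vertex_scaling u d e = 2 * arsinh (exp ((\<Sum>i\<in>e. u i) / 2) * sinh (d e / 2))"

lemma sinh_vertex_scaling:
  assumes "i \<noteq> j"
  shows "sinh (vertex_scaling u d {i, j} / 2) = exp ((u i + u j) / 2) * sinh (d {i, j} / 2)"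
  using assms by (simp add: vertex_scaling_def)

text \<open>The extended angle at i in the face with vertices i, j, k.\<close>

definition ext_angle :: "(nat set \<Rightarrow> real) \<Rightarrow> nat \<Rightarrow> nat \<Rightarrow> nat \<Rightarrow> real" where
  "ext_angle d i j k =
     (if strict_triangle (d {j, k}) (d {i, j}) (d {i, k})
      then interior_angle (d {j, k}) (d {i, j}) (d {i, k})
      else if d {j, k} \<ge> d {i, j} + d {i, k} then pi
      else 0)"

text \<open>
  Each face containing i is counted exactly once: it is {i, j, k} for a unique pair j < k, and
  every face has three distinct vertices.
\<close>

definition gen_curvature :: "nat set set \<Rightarrow> (nat set \<Rightarrow> real) \<Rightarrow> (nat \<Rightarrow> real) \<Rightarrow> nat \<Rightarrow> real" where
  "gen_curvature F d\<^sub>0 u i =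
     2 * pi - (\<Sum>(j, k)\<in>{(j, k). j < k \<and> {i, j, k} \<in> F}. ext_angle (vertex_scaling u d\<^sub>0) i j k)"

text \<open>
  Functions of time and vertex take the time first; their values at negative times and outside V
  are irrelevant. The derivative at time 0 is one-sided.
\<close>

definition extended_Yamabe_flow ::
    "nat set \<Rightarrow> nat set set \<Rightarrow> (nat set \<Rightarrow> real) \<Rightarrow> (real \<Rightarrow> nat \<Rightarrow> real) \<Rightarrow> bool" where
  "extended_Yamabe_flow V F d\<^sub>0 u \<longleftrightarrow> (\<forall>i\<in>V. \<exists>u'. continuous_on {0..} u' \<and>
     (\<forall>t\<ge>0. ((\<lambda>s. u s i) has_real_derivative u' t) (at t within {0..}) \<and>
        u' t = - gen_curvature F d\<^sub>0 (u t) i))"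

definition L1_l1 :: "nat set \<Rightarrow> real \<Rightarrow> (real \<Rightarrow> nat \<Rightarrow> real) \<Rightarrow> bool" where
  "L1_l1 V T f \<longleftrightarrow>
     (\<forall>i\<in>V. (\<lambda>t. f t i) \<in> borel_measurable (lebesgue_on {0..<T})) \<and>
     (\<integral>\<^sup>+ t. (\<integral>\<^sup>+ i. ennreal \<bar>f t i\<bar> \<partial>count_space V) \<partial>lebesgue_on {0..<T}) < \<infinity>"

end

theory Submission
  imports Defs
begin

text \<open>
  On a single triangle the extended angles are monotone: the sum of
  \<open>(\<theta>\<^sub>i(u) - \<theta>\<^sub>i(v)) (u\<^sub>i - v\<^sub>i)\<close> over its three vertices is nonpositive, because along the segment
  from \<open>v\<close> to \<open>u\<close> the function \<open>\<Sum> \<theta>\<^sub>i (u\<^sub>i - v\<^sub>i)\<close> has nonpositive derivative where the triangle is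
  nondegenerate and takes only finitely many values elsewhere. Hence the energy
  \<open>\<Sum>\<^bsub>i\<in>S\<^esub> (u\<^sub>i - v\<^sub>i)\<^sup>2\<close> of a finite vertex set \<open>S\<close> can grow only through faces that leave \<open>S\<close>, at a
  rate bounded by a constant times \<open>\<Sum> \<bar>u\<^sub>i - v\<^sub>i\<bar>\<close> over the boundary vertices of \<open>S\<close>. The
  integrability of the \<open>l\<^sup>1\<close> norm makes the time integral of that bound arbitrarily small as \<open>S\<close>
  exhausts \<open>V\<close>.
\<close>

section \<open>Extended angles in half-length coordinates\<close>

definition clamp1 :: "real \<Rightarrow> real" where
  "clamp1 x = max (-1) (min 1 x)"

text \<open>
  The arguments are \<open>cosh\<^sup>2\<close> of half the side lengths, the first one belonging to the opposite side.
  In these coordinates a vertex scaling acts on \<open>\<alpha> - 1\<close> by a factor, and the degenerate values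
  \<open>0\<close> and \<open>\<pi>\<close> of the extended angle come from clamping its cosine to \<open>[-1, 1]\<close>.
\<close>

definition half_angle_cos :: "real \<Rightarrow> real \<Rightarrow> real \<Rightarrow> real" where
  "half_angle_cos \<alpha> \<beta> \<gamma> =
     (2 * \<beta> * \<gamma> - (\<alpha> + \<beta> + \<gamma> - 1)) / (2 * sqrt (\<beta> * (\<beta> - 1) * (\<gamma> * (\<gamma> - 1))))"

definition half_angle :: "real \<Rightarrow> real \<Rightarrow> real \<Rightarrow> real" where
  "half_angle \<alpha> \<beta> \<gamma> = arccos (clamp1 (half_angle_cos \<alpha> \<beta> \<gamma>))"

text \<open>The double-argument formulas for \<open>cosh\<close> and \<open>sinh\<close> turn the
  hyperbolic law of cosines into an algebraic expression in \<open>cosh\<^sup>2\<close> of the half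
  lengths.\<close>

lemma half_angle_cos_cosh:
  fixes a b c :: real
  assumes "0 < b" "0 < c"
  shows "half_angle_cos ((cosh (a / 2))\<^sup>2) ((cosh (b / 2))\<^sup>2) ((cosh (c / 2))\<^sup>2) =
    (cosh b * cosh c - cosh a) / (sinh b * sinh c)"
proof -
  have ch: "cosh x = 2 * (cosh (x / 2))\<^sup>2 - 1" for x :: real
    using cosh_double_cosh[of "x / 2"] by simp
  have sh: "sinh x = 2 * sinh (x / 2) * cosh (x / 2)" for x :: real
    using sinh_double[of "x / 2"] by simp
  have sq: "(cosh (x / 2))\<^sup>2 - 1 = (sinh (x / 2))\<^sup>2" for x :: real
    using cosh_square_eq[of "x / 2"] by simp
  have "sqrt ((cosh (b / 2))\<^sup>2 * ((cosh (b / 2))\<^sup>2 - 1) * ((cosh (c / 2))\<^sup>2 * ((cosh (c / 2))\<^sup>2 - 1)))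
      = cosh (b / 2) * sinh (b / 2) * (cosh (c / 2) * sinh (c / 2))"
    using assms unfolding sq by (simp add: real_sqrt_mult)
  then have den: "4 * sqrt ((cosh (b / 2))\<^sup>2 * ((cosh (b / 2))\<^sup>2 - 1) * ((cosh (c / 2))\<^sup>2 * ((cosh (c / 2))\<^sup>2 - 1)))
      = sinh b * sinh c"
    unfolding sh[of b] sh[of c] by simp
  have num: "2 * (2 * (cosh (b / 2))\<^sup>2 * (cosh (c / 2))\<^sup>2 - ((cosh (a / 2))\<^sup>2 + (cosh (b / 2))\<^sup>2 + (cosh (c / 2))\<^sup>2 - 1))
     = cosh b * cosh c - cosh a"
    unfolding ch[of a] ch[of b] ch[of c] by (simp add: algebra_simps)
  show ?thesis
    unfolding half_angle_cos_def num[symmetric] den[symmetric]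
      by (simp add: divide_simps)
qed

text \<open>By the addition formulas, the quotient in the law of cosines is at most -1 exactly when
  the opposite side is at least the sum of the others, and at least 1 exactly when it is at most
  their difference. Clamping therefore produces the conventional values \<open>pi\<close> and 0 in
  precisely the right cases.\<close>

lemma ext_angle_eq_half_angle:
  assumes pos: "0 < d {i, j}" "0 < d {i, k}" "0 < d {j, k}"
  shows "ext_angle d i j k =
    half_angle ((cosh (d {j, k} / 2))\<^sup>2) ((cosh (d {i, j} / 2))\<^sup>2) ((cosh (d {i, k} / 2))\<^sup>2)"
proof -
  define a b c where "a = d {j, k}" and "b = d {i, j}" and "c = d {i, k}"
  have p: "0 < a" "0 < b" "0 < c" using pos by (auto simp: a_def b_def c_def)
  define q where "q = (cosh b * cosh c - cosh a) / (sinh b * sinh c)"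
  have s: "sinh b * sinh c > 0" using p by simp
  have lo: "q \<le> -1 \<longleftrightarrow> b + c \<le> a"
  proof -
    have "q \<le> -1 \<longleftrightarrow> cosh (b + c) \<le> cosh a"
      using s by (simp add: q_def pos_divide_le_eq cosh_add algebra_simps)
    then show ?thesis using p by (simp add: cosh_real_nonneg_le_iff)
  qed
  have hi: "1 \<le> q \<longleftrightarrow> a \<le> \<bar>b - c\<bar>"
  proof -
    have "1 \<le> q \<longleftrightarrow> cosh a \<le> cosh \<bar>b - c\<bar>"
      using s unfolding cosh_real_abs by (simp add: q_def pos_le_divide_eq cosh_diff algebra_simps)
    also have "\<dots> \<longleftrightarrow> a \<le> \<bar>b - c\<bar>"
      using p by (intro cosh_real_nonneg_le_iff) auto
    finally show ?thesis .
  qed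
  have "ext_angle d i j k = arccos (clamp1 q)"
  proof (cases "strict_triangle a b c")
    case True
    then have "-1 < q" "q < 1"
      using lo hi by (auto simp: strict_triangle_def not_le[symmetric])
    with True show ?thesis
      using interior_angle_eq[OF p True]
      by (simp add: ext_angle_def a_def b_def c_def q_def clamp1_def)
  next
    case False
    show ?thesis
    proof (cases "b + c \<le> a")
      case True
      then have "q \<le> -1" using lo by simp
      then have "clamp1 q = -1" by (simp add: clamp1_def)
      then show ?thesis using True False by (simp add: ext_angle_def a_def b_def c_def)
    next
      case nt: False
      then have "1 \<le> q" using False hi by (auto simp: strict_triangle_def)
      then have "clamp1 q = 1" by (simp add: clamp1_def)
      then show ?thesis using nt False by (simp add: ext_angle_def a_def b_def c_def)
    qed
  qed
  then show ?thesis
    using half_angle_cos_cosh[of b c a] p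
    by (simp add: half_angle_def q_def a_def b_def c_def)
qed

lemma half_angle_swap: "half_angle \<alpha> \<beta> \<gamma> = half_angle \<alpha> \<gamma> \<beta>"
  by (simp add: half_angle_def half_angle_cos_def algebra_simps)

lemma half_angle_bounds: "0 \<le> half_angle \<alpha> \<beta> \<gamma>" "half_angle \<alpha> \<beta> \<gamma> \<le> pi"
  by (auto simp: half_angle_def clamp1_def intro!: arccos_lbound arccos_ubound)

section \<open>Infinitesimal monotonicity on a nondegenerate triangle\<close>

text \<open>
  Completing the square in \<open>x\<close> leaves \<open>G / \<alpha>\<close> times
  \<open>(y - z)\<^sup>2 + (\<alpha> - 1) (y\<^sup>2 / \<beta> + z\<^sup>2 / \<gamma>)\<close>.
\<close>

lemma quadratic_form_nonneg:
  fixes \<alpha> \<beta> \<gamma> x y z :: real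
  assumes "1 < \<alpha>" "1 < \<beta>" "1 < \<gamma>" and s: "s = \<alpha> + \<beta> + \<gamma> - 1" and "s\<^sup>2 < 4 * \<alpha> * \<beta> * \<gamma>"
  shows "0 \<le> s * (1 - 1 / \<alpha>) * x\<^sup>2 + s * (1 - 1 / \<beta>) * y\<^sup>2 + s * (1 - 1 / \<gamma>) * z\<^sup>2 +
    2 * ((2 * \<alpha> - s) * y * z + (2 * \<beta> - s) * x * z + (2 * \<gamma> - s) * x * y)" (is "0 \<le> ?T")
proof -
  \<comment> \<open>\<open>m\<close> is the coefficient of \<open>x\<^sup>2\<close>; multiplying the
    form by it lets the square be completed without division. \<open>G\<close> is positive by the
    last assumption.\<close>
  define m where "m = s * (1 - 1 / \<alpha>)"
  define G where "G = 4 * \<alpha> * \<beta> * \<gamma> - s\<^sup>2"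
  have m: "m > 0" using assms by (simp add: m_def)
  have nz: "\<alpha> \<noteq> 0" "\<beta> \<noteq> 0" "\<gamma> \<noteq> 0" using assms by auto
  have c22: "m * (s * (1 - 1 / \<beta>)) = (2 * \<gamma> - s)\<^sup>2 + G / \<alpha> * (1 + (\<alpha> - 1) / \<beta>)"
    using nz unfolding m_def G_def s by (simp add: field_simps) algebra
  have c33: "m * (s * (1 - 1 / \<gamma>)) = (2 * \<beta> - s)\<^sup>2 + G / \<alpha> * (1 + (\<alpha> - 1) / \<gamma>)"
    using nz unfolding m_def G_def s by (simp add: field_simps) algebra
  have c23: "m * (2 * \<alpha> - s) = (2 * \<gamma> - s) * (2 * \<beta> - s) - G / \<alpha>"
    using nz unfolding m_def G_def s by (simp add: field_simps) algebra
  have "m * ?T = m\<^sup>2 * x\<^sup>2 + (m * (s * (1 - 1 / \<beta>))) * y\<^sup>2 + (m * (s * (1 - 1 / \<gamma>))) * z\<^sup>2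
     + 2 * ((m * (2 * \<alpha> - s)) * y * z + m * (2 * \<beta> - s) * x * z + m * (2 * \<gamma> - s) * x * y)"
    unfolding m_def[symmetric] by (simp add: distrib_left power2_eq_square mult.assoc mult.left_commute)
  also have "\<dots> = (m * x + (2 * \<gamma> - s) * y + (2 * \<beta> - s) * z)\<^sup>2
     + G / \<alpha> * ((y - z)\<^sup>2 + (\<alpha> - 1) / \<beta> * y\<^sup>2 + (\<alpha> - 1) / \<gamma> * z\<^sup>2)"
    unfolding c22 c33 c23 by (simp add: distrib_left distrib_right left_diff_distrib right_diff_distrib
        power2_eq_square mult_ac del: times_divide_eq_left times_divide_eq_right)
  also have "\<dots> \<ge> 0"
    using assms by (intro add_nonneg_nonneg mult_nonneg_nonneg divide_nonneg_nonneg) (auto simp: G_def)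
  finally show ?thesis using m by (simp add: zero_le_mult_iff)
qed

text \<open>The numerator is symmetric in the three arguments, so its sign decides degeneracy at all
  three vertices at once. Four times it is
  \<open>1 + 2 A B C - A\<^sup>2 - B\<^sup>2 - C\<^sup>2\<close>, where
  \<open>A = 2 \<alpha> - 1\<close> is the \<open>cosh\<close> of the side and \<open>B\<close>,
  \<open>C\<close> are formed likewise.\<close>

lemma half_angle_cos_square:
  fixes \<alpha> \<beta> \<gamma> :: real
  assumes "1 < \<beta>" "1 < \<gamma>"
  shows "1 - (half_angle_cos \<alpha> \<beta> \<gamma>)\<^sup>2 =
    (4 * \<alpha> * \<beta> * \<gamma> - (\<alpha> + \<beta> + \<gamma> - 1)\<^sup>2) / (2 * sqrt (\<beta> * (\<beta> - 1) * (\<gamma> * (\<gamma> - 1))))\<^sup>2"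
proof -
  have "0 < \<beta> * (\<beta> - 1) * (\<gamma> * (\<gamma> - 1))" using assms by simp
  then have sq: "(2 * sqrt (\<beta> * (\<beta> - 1) * (\<gamma> * (\<gamma> - 1))))\<^sup>2 = 4 * (\<beta> * (\<beta> - 1) * (\<gamma> * (\<gamma> - 1)))"
    by (simp add: power_mult_distrib)
  have num: "4 * \<alpha> * \<beta> * \<gamma> - (\<alpha> + \<beta> + \<gamma> - 1)\<^sup>2 =
      4 * (\<beta> * (\<beta> - 1) * (\<gamma> * (\<gamma> - 1))) - (2 * \<beta> * \<gamma> - (\<alpha> + \<beta> + \<gamma> - 1))\<^sup>2"
    by algebra
  show ?thesis
    unfolding half_angle_cos_def power_divide num
    using assms by (simp add: sq diff_divide_distrib)
qed

lemma half_angle_degenerate: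
  assumes "1 < \<beta>" "1 < \<gamma>" "4 * \<alpha> * \<beta> * \<gamma> \<le> (\<alpha> + \<beta> + \<gamma> - 1)\<^sup>2"
  shows "half_angle \<alpha> \<beta> \<gamma> \<in> {0, pi}"
proof -
  have "1 - (half_angle_cos \<alpha> \<beta> \<gamma>)\<^sup>2 \<le> 0"
    unfolding half_angle_cos_square[OF assms(1,2)]
    using assms(3) by (intro divide_nonpos_nonneg) auto
  then have "1 \<le> \<bar>half_angle_cos \<alpha> \<beta> \<gamma>\<bar>"
    using abs_le_square_iff[of 1 "half_angle_cos \<alpha> \<beta> \<gamma>"] by simp
  then have "clamp1 (half_angle_cos \<alpha> \<beta> \<gamma>) \<in> {-1, 1}"
    by (auto simp: clamp1_def)
  then show ?thesis by (auto simp: half_angle_def)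
qed

lemma DERIV_arccos_clamp1:
  assumes "\<bar>x\<bar> < 1"
  shows "((\<lambda>x. arccos (clamp1 x)) has_real_derivative inverse (- sqrt (1 - x\<^sup>2))) (at x)"
proof (rule has_field_derivative_transform_within_open)
  show "(arccos has_real_derivative inverse (- sqrt (1 - x\<^sup>2))) (at x)"
    using assms by (intro DERIV_arccos) auto
  show "open {-1<..<1::real}" "x \<in> {-1<..<1}" using assms by auto
qed (auto simp: clamp1_def)

text \<open>Here \<open>x\<close>, \<open>y\<close>, \<open>z\<close> are the logarithmic speeds of
  \<open>\<alpha> - 1\<close>, \<open>\<beta> - 1\<close>, \<open>\<gamma> - 1\<close>, as under a
  vertex scaling. The normalization \<open>Y\<close> of the cosine cancels against the derivative of
  \<open>arccos\<close>, which leaves a denominator common to the three angles of the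
  triangle.\<close>

lemma half_angle_has_derivative:
  fixes \<alpha> \<beta> \<gamma> :: "real \<Rightarrow> real"
  assumes pos: "1 < \<beta> t" "1 < \<gamma> t"
    and G: "(\<alpha> t + \<beta> t + \<gamma> t - 1)\<^sup>2 < 4 * \<alpha> t * \<beta> t * \<gamma> t"
    and d: "(\<alpha> has_real_derivative (\<alpha> t - 1) * x) (at t)"
      "(\<beta> has_real_derivative (\<beta> t - 1) * y) (at t)"
      "(\<gamma> has_real_derivative (\<gamma> t - 1) * z) (at t)"
    and s: "s = \<alpha> t + \<beta> t + \<gamma> t - 1"
  shows "((\<lambda>t. half_angle (\<alpha> t) (\<beta> t) (\<gamma> t)) has_real_derivative
    - (- (\<alpha> t - 1) * x + (\<alpha> t - s / (2 * \<beta> t)) * y + (\<alpha> t - s / (2 * \<gamma> t)) * z) /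
      sqrt (4 * \<alpha> t * \<beta> t * \<gamma> t - s\<^sup>2)) (at t)"
proof -
  define W where "W t = \<beta> t * (\<beta> t - 1) * (\<gamma> t * (\<gamma> t - 1))" for t
  define Y where "Y = 2 * sqrt (W t)"
  define X where "X = 2 * \<beta> t * \<gamma> t - s"
  define X' where "X' = 2 * (\<beta> t - 1) * y * \<gamma> t + 2 * \<beta> t * (\<gamma> t - 1) * z
     - ((\<alpha> t - 1) * x + (\<beta> t - 1) * y + (\<gamma> t - 1) * z)"
  \<comment> \<open>\<open>L\<close> is the logarithmic derivative of \<open>Y\<close>, hence half
    that of \<open>W\<close>.\<close>
  define L where "L = (y + z) - y / (2 * \<beta> t) - z / (2 * \<gamma> t)"
  have W: "W t > 0" using pos by (simp add: W_def)
  then have Y: "Y > 0" by (simp add: Y_def)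
  have YY: "sqrt (W t) * sqrt (W t) = W t" using W by simp
  have nz: "\<beta> t \<noteq> 0" "\<gamma> t \<noteq> 0" using pos by auto
  have dW: "(W has_real_derivative 2 * W t * L) (at t)"
    unfolding W_def[abs_def]
    by (rule derivative_eq_intros d refl)+ (use nz in \<open>simp add: L_def field_simps\<close>)
  have dY: "((\<lambda>t. 2 * sqrt (W t)) has_real_derivative Y * L) (at t)"
    using W by (auto intro!: derivative_eq_intros dW simp: Y_def field_simps YY)
  have dX: "((\<lambda>t. 2 * \<beta> t * \<gamma> t - (\<alpha> t + \<beta> t + \<gamma> t - 1)) has_real_derivative X') (at t)"
    by (rule derivative_eq_intros d refl)+ (simp add: X'_def algebra_simps)
  have dc: "((\<lambda>t. half_angle_cos (\<alpha> t) (\<beta> t) (\<gamma> t)) has_real_derivative (X' - X * L) / Y) (at t)"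
    unfolding half_angle_cos_def W_def[symmetric]
  proof (rule DERIV_cong[OF DERIV_divide[OF dX dY]])
    show "2 * sqrt (W t) \<noteq> 0" using W by simp
    have "(X' * Y - X * (Y * L)) / (Y * Y) = (X' - X * L) / Y"
      using Y by (simp add: field_simps)
    then show "(X' * (2 * sqrt (W t)) - (2 * \<beta> t * \<gamma> t - (\<alpha> t + \<beta> t + \<gamma> t - 1)) * (Y * L)) /
        (2 * sqrt (W t) * (2 * sqrt (W t))) = (X' - X * L) / Y"
      unfolding Y_def[symmetric] X_def s .
  qed
  define q where "q = half_angle_cos (\<alpha> t) (\<beta> t) (\<gamma> t)"
  define g where "g = 4 * \<alpha> t * \<beta> t * \<gamma> t - s\<^sup>2"
  have g: "g > 0" using G by (simp add: g_def s)
  have q: "1 - q\<^sup>2 = g / Y\<^sup>2"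
    unfolding q_def half_angle_cos_square[OF pos] by (simp add: g_def s Y_def W_def)
  then have "q\<^sup>2 < 1" using g Y by (smt (verit) zero_less_divide_iff zero_less_power)
  then have q1: "\<bar>q\<bar> < 1" by (simp add: abs_square_less_1)
  have sq: "sqrt (1 - q\<^sup>2) = sqrt g / Y"
    unfolding q using Y by (simp add: real_sqrt_divide)
  have "((\<lambda>t. arccos (clamp1 (half_angle_cos (\<alpha> t) (\<beta> t) (\<gamma> t)))) has_real_derivative
      inverse (- sqrt (1 - q\<^sup>2)) * ((X' - X * L) / Y)) (at t)"
    unfolding q_def by (rule DERIV_chain2[OF DERIV_arccos_clamp1 dc]) (use q1 in \<open>simp add: q_def\<close>)
  moreover have "inverse (- sqrt (1 - q\<^sup>2)) * ((X' - X * L) / Y) = - (X' - X * L) / sqrt g"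
    unfolding sq using Y by (simp add: divide_simps)
  moreover have "X' - X * L = - (\<alpha> t - 1) * x + (\<alpha> t - s / (2 * \<beta> t)) * y + (\<alpha> t - s / (2 * \<gamma> t)) * z"
    using nz unfolding X'_def X_def L_def s by (simp add: field_simps)
  ultimately show ?thesis
    by (simp add: half_angle_def g_def)
qed

section \<open>From infinitesimal to finite displacements\<close>

text \<open>
  If \<open>g\<close> increased, it would cross some level outside \<open>C\<close> for the last time from below, but near
  that crossing it is nonincreasing. Nothing is assumed about the preimage of \<open>C\<close>, so the
  degenerate times may be an arbitrary closed set.
\<close>

lemma DERIV_nonpos_off_finite_imp_le:
  fixes g :: "real \<Rightarrow> real"
  assumes cont: "continuous_on UNIV g" and C: "finite C"
    and der: "\<And>t. g t \<notin> C \<Longrightarrow> \<exists>d\<le>0. (g has_real_derivative d) (at t)"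
    and "a \<le> b"
  shows "g b \<le> g a"
proof (rule ccontr)
  assume "\<not> g b \<le> g a"
  then have "g a < g b" by simp
  then have "infinite ({g a<..<g b} - C)"
    using C by (simp add: infinite_Ioo)
  then have "{g a<..<g b} - C \<noteq> {}" by force
  then obtain y where y: "g a < y" "y < g b" "y \<notin> C"
    by (metis (no_types) DiffD1 DiffD2 ex_in_conv greaterThanLessThan_iff)
  define Z where "Z = {t \<in> {a..b}. g t \<le> y}"
  have cab: "continuous_on {a..b} g" using cont continuous_on_subset by blast
  have "closed Z"
    unfolding Z_def by (intro continuous_on_closed_Collect_le cab continuous_intros closed_atLeastAtMost)
  moreover have "bounded Z"
    by (rule bounded_subset[of "{a..b}"]) (auto simp: Z_def)
  ultimately have "compact Z" by (simp add: compact_eq_bounded_closed)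
  moreover have "Z \<noteq> {}" using \<open>a \<le> b\<close> y by (auto simp: Z_def)
  ultimately obtain s where s: "s \<in> Z" and smax: "\<And>t. t \<in> Z \<Longrightarrow> t \<le> s"
    using compact_attains_sup[of Z] by auto
  have "s \<noteq> b" using s y by (auto simp: Z_def)
  then have sb: "s < b" "a \<le> s" "g s \<le> y"
    using s by (auto simp: Z_def)
  \<comment> \<open>The intermediate time \<open>z\<close> lies in \<open>Z\<close> and is not
    before \<open>s\<close>, so by maximality \<open>s\<close> itself is at level
    \<open>y\<close>.\<close>
  obtain z where "s \<le> z" "z \<le> b" "g z = y"
    using IVT'[of g s y b] sb y continuous_on_subset[OF cont] by auto
  with smax[of z] sb have gs: "g s = y" by (auto simp: Z_def)
  have "open (- C)" using C by (simp add: finite_imp_closed open_Compl)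
  then have "open (g -` (- C))"
    using cont by (simp add: continuous_on_open_vimage)
  moreover have "s \<in> g -` (- C)" using gs y by simp
  ultimately obtain e where e: "e > 0" "ball s e \<subseteq> g -` (- C)"
    using openE by blast
  \<comment> \<open>Halving \<open>e\<close> keeps all of \<open>[s, w]\<close> inside the ball on
    which \<open>g\<close> avoids \<open>C\<close>; the minimum keeps \<open>w\<close> within
    \<open>[a, b]\<close>.\<close>
  define w where "w = min b (s + e / 2)"
  have w: "s < w" "w \<le> b" using sb e by (auto simp: w_def)
  have "g w \<le> g s"
  proof (rule DERIV_nonpos_imp_nonincreasing[where f = g])
    fix t assume "s \<le> t" "t \<le> w"
    then have "t \<in> ball s e" using e by (auto simp: w_def dist_real_def)
    then have "g t \<notin> C" using e by blast
    then show "\<exists>d. (g has_real_derivative d) (at t) \<and> d \<le> 0"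
      using der[of t] by blast
  qed (use w in simp)
  then have "w \<in> Z" using w sb gs by (auto simp: Z_def)
  then show False using smax w by fastforce
qed

lemma continuous_on_half_angle [continuous_intros]:
  fixes \<alpha> \<beta> \<gamma> :: "real \<Rightarrow> real"
  assumes "continuous_on S \<alpha>" "continuous_on S \<beta>" "continuous_on S \<gamma>"
    and "\<And>t. t \<in> S \<Longrightarrow> 1 < \<beta> t" "\<And>t. t \<in> S \<Longrightarrow> 1 < \<gamma> t"
  shows "continuous_on S (\<lambda>t. half_angle (\<alpha> t) (\<beta> t) (\<gamma> t))"
proof -
  have "2 * sqrt (\<beta> t * (\<beta> t - 1) * (\<gamma> t * (\<gamma> t - 1))) \<noteq> 0" if "t \<in> S" for t
    using assms(4,5)[OF that] by simp
  then show ?thesis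
    unfolding half_angle_def half_angle_cos_def clamp1_def
    by (intro continuous_intros assms ballI) auto
qed

text \<open>Weighting the angle derivatives by the vertex speeds \<open>x\<close>, \<open>y\<close>,
  \<open>z\<close> gives, up to sign and a positive factor, the form of
  \<open>quadratic_form_nonneg\<close> evaluated at the edge speeds \<open>y + z\<close>,
  \<open>x + z\<close>, \<open>x + y\<close>.\<close>

lemma half_angle_quadratic_form:
  fixes \<alpha> \<beta> \<gamma> x y z :: real
  assumes s: "s = \<alpha> + \<beta> + \<gamma> - 1"
  shows "2 * (x * (- (\<alpha> - 1) * (y + z) + (\<alpha> - s / (2 * \<beta>)) * (x + z) + (\<alpha> - s / (2 * \<gamma>)) * (x + y))
      + y * (- (\<beta> - 1) * (x + z) + (\<beta> - s / (2 * \<alpha>)) * (y + z) + (\<beta> - s / (2 * \<gamma>)) * (x + y))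
      + z * (- (\<gamma> - 1) * (x + y) + (\<gamma> - s / (2 * \<alpha>)) * (y + z) + (\<gamma> - s / (2 * \<beta>)) * (x + z))) =
    s * (1 - 1 / \<alpha>) * (y + z)\<^sup>2 + s * (1 - 1 / \<beta>) * (x + z)\<^sup>2 + s * (1 - 1 / \<gamma>) * (x + y)\<^sup>2 +
    2 * ((2 * \<alpha> - s) * (x + z) * (x + y) + (2 * \<beta> - s) * (y + z) * (x + y) + (2 * \<gamma> - s) * (y + z) * (x + z))"
proof -
  \<comment> \<open>Naming the fractions reduces the claim to a polynomial identity.\<close>
  define p q r where "p = s / (2 * \<alpha>)" and "q = s / (2 * \<beta>)" and "r = s / (2 * \<gamma>)"
  have "s * (1 - 1 / \<alpha>) = s - 2 * p" "s * (1 - 1 / \<beta>) = s - 2 * q" "s * (1 - 1 / \<gamma>) = s - 2 * r"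
    by (simp_all add: p_def q_def r_def right_diff_distrib)
  note * = this p_def[symmetric] q_def[symmetric] r_def[symmetric]
  show ?thesis
    unfolding * unfolding s by (simp add: algebra_simps power2_eq_square)
qed

text \<open>The parameter \<open>t\<close> runs along the segment of scaling factors with direction
  \<open>(x, y, z)\<close>. Where the triangle is nondegenerate, \<open>g\<close> has nonpositive
  derivative; elsewhere all angles are 0 or \<open>pi\<close>, so \<open>g\<close> lies in a finite
  set.\<close>

lemma half_angle_scaling_monotone:
  fixes P Q R x y z :: real
  assumes pos: "0 < P" "0 < Q" "0 < R"
  defines "\<alpha> \<equiv> \<lambda>t. 1 + P * exp (t * (y + z))"
    and "\<beta> \<equiv> \<lambda>t. 1 + Q * exp (t * (x + z))"
    and "\<gamma> \<equiv> \<lambda>t. 1 + R * exp (t * (x + y))"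
  defines "g \<equiv> \<lambda>t. x * half_angle (\<alpha> t) (\<beta> t) (\<gamma> t) + y * half_angle (\<beta> t) (\<alpha> t) (\<gamma> t) +
    z * half_angle (\<gamma> t) (\<alpha> t) (\<beta> t)"
  shows "g 1 \<le> g 0"
proof -
  \<comment> \<open>All combinations of 0 and \<open>pi\<close> are listed, so it is irrelevant
    which vertex carries the angle \<open>pi\<close>.\<close>
  let ?C = "(\<lambda>(p, q, r). x * p + y * q + z * r) ` ({0, pi} \<times> {0, pi} \<times> {0, pi})"
  have gt: "1 < \<alpha> t" "1 < \<beta> t" "1 < \<gamma> t" for t
    using pos by (auto simp: \<alpha>_def \<beta>_def \<gamma>_def)
  have cont: "continuous_on S \<alpha>" "continuous_on S \<beta>" "continuous_on S \<gamma>" for S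
    unfolding \<alpha>_def \<beta>_def \<gamma>_def by (intro continuous_intros)+
  have cont_g: "continuous_on UNIV g"
    unfolding g_def by (intro continuous_intros cont gt)
  have "\<exists>d\<le>0. (g has_real_derivative d) (at t)" if "g t \<notin> ?C" for t
  proof -
  define s where "s = \<alpha> t + \<beta> t + \<gamma> t - 1"
  have s: "s = \<beta> t + \<alpha> t + \<gamma> t - 1" "s = \<gamma> t + \<alpha> t + \<beta> t - 1"
    by (simp_all add: s_def algebra_simps)
  \<comment> \<open>A failure of this inequality degenerates all three angles simultaneously and
    puts \<open>g t\<close> into \<open>?C\<close>.\<close>
  have G: "s\<^sup>2 < 4 * \<alpha> t * \<beta> t * \<gamma> t"
  proof (rule ccontr)
    assume "\<not> ?thesis"
    then have "half_angle (\<alpha> t) (\<beta> t) (\<gamma> t) \<in> {0, pi}" "half_angle (\<beta> t) (\<alpha> t) (\<gamma> t) \<in> {0, pi}"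
      "half_angle (\<gamma> t) (\<alpha> t) (\<beta> t) \<in> {0, pi}"
      using gt[of t] by (intro half_angle_degenerate; simp add: s_def algebra_simps)+
    then have "g t \<in> ?C" unfolding g_def by (intro image_eqI[where x = "(_, _, _)"]) auto
    with \<open>g t \<notin> ?C\<close> show False by simp
  qed
  define r where "r = sqrt (4 * \<alpha> t * \<beta> t * \<gamma> t - s\<^sup>2)"
  have r: "r > 0" using G by (simp add: r_def)
  have r': "sqrt (4 * \<beta> t * \<alpha> t * \<gamma> t - s\<^sup>2) = r" "sqrt (4 * \<gamma> t * \<alpha> t * \<beta> t - s\<^sup>2) = r"
    by (simp_all add: r_def mult_ac)
  have d: "(\<alpha> has_real_derivative (\<alpha> t - 1) * (y + z)) (at t)"
    "(\<beta> has_real_derivative (\<beta> t - 1) * (x + z)) (at t)"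
    "(\<gamma> has_real_derivative (\<gamma> t - 1) * (x + y)) (at t)"
    unfolding \<alpha>_def \<beta>_def \<gamma>_def by (auto intro!: derivative_eq_intros)
  have G': "s\<^sup>2 < 4 * \<beta> t * \<alpha> t * \<gamma> t" "s\<^sup>2 < 4 * \<gamma> t * \<alpha> t * \<beta> t"
    using G by (simp_all add: mult_ac)
  note d1 = half_angle_has_derivative[OF gt(2,3) G[unfolded s_def] d s_def, folded r_def]
  note d2 = half_angle_has_derivative[OF gt(1,3) G'(1)[unfolded s(1)] d(2,1,3) s(1), unfolded r']
  note d3 = half_angle_has_derivative[OF gt(1,2) G'(2)[unfolded s(2)] d(3,1,2) s(2), unfolded r']
  define T where "T = s * (1 - 1 / \<alpha> t) * (y + z)\<^sup>2 + s * (1 - 1 / \<beta> t) * (x + z)\<^sup>2 + s * (1 - 1 / \<gamma> t) * (x + y)\<^sup>2 +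
    2 * ((2 * \<alpha> t - s) * (x + z) * (x + y) + (2 * \<beta> t - s) * (y + z) * (x + y) + (2 * \<gamma> t - s) * (y + z) * (x + z))"
  have T: "0 \<le> T"
    unfolding T_def by (rule quadratic_form_nonneg[OF gt s_def G])
  have lin: "x * (- a / r) + y * (- b / r) + z * (- c / r) = - T / (2 * r)"
    if "2 * (x * a + y * b + z * c) = T" for a b c
    using r unfolding that[symmetric] by (simp add: field_simps)
  have "(g has_real_derivative - T / (2 * r)) (at t)"
    unfolding g_def
    by (rule DERIV_cong[OF DERIV_add[OF DERIV_add[OF DERIV_cmult[OF d1] DERIV_cmult[OF d2]] DERIV_cmult[OF d3]]],
      rule lin, unfold T_def, rule half_angle_quadratic_form[OF s_def])
  moreover have "- T / (2 * r) \<le> 0" using T r by (simp add: divide_nonpos_pos)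
  ultimately show ?thesis by blast
  qed
  then show ?thesis
    by (intro DERIV_nonpos_off_finite_imp_le[OF cont_g, where C = ?C]) auto
qed

section \<open>Monotonicity of the extended angles under vertex scaling\<close>

lemma vertex_scaling_pos:
  assumes "i \<noteq> j" "0 < d {i, j}"
  shows "0 < vertex_scaling u d {i, j}"
  using assms by (simp add: vertex_scaling_def)

lemma cosh_square_vertex_scaling:
  assumes "i \<noteq> j"
  shows "(cosh (vertex_scaling u d {i, j} / 2))\<^sup>2 = 1 + (sinh (d {i, j} / 2))\<^sup>2 * exp (u i + u j)"
proof -
  have "(exp ((u i + u j) / 2))\<^sup>2 = exp (u i + u j)"
    by (simp add: power2_eq_square flip: exp_add)
  then show ?thesis
    using cosh_square_eq[of "vertex_scaling u d {i, j} / 2"] sinh_vertex_scaling[OF assms, of u d]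
    by (simp add: power_mult_distrib mult.commute)
qed

lemma ext_angle_swap:
  assumes "0 < d {i, j}" "0 < d {i, k}" "0 < d {j, k}"
  shows "ext_angle d i j k = ext_angle d i k j"
  using assms ext_angle_eq_half_angle[of d i j k] ext_angle_eq_half_angle[of d i k j]
  by (simp add: insert_commute half_angle_swap)

lemma ext_angle_bounds:
  assumes "0 < d {i, j}" "0 < d {i, k}" "0 < d {j, k}"
  shows "0 \<le> ext_angle d i j k" "ext_angle d i j k \<le> pi"
  unfolding ext_angle_eq_half_angle[OF assms] by (rule half_angle_bounds)+

lemma ext_angle_vertex_scaling:
  assumes "i \<noteq> j" "i \<noteq> k" "j \<noteq> k" "0 < d {i, j}" "0 < d {i, k}" "0 < d {j, k}"
  shows "ext_angle (vertex_scaling u d) i j k = half_angle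
    (1 + (sinh (d {j, k} / 2))\<^sup>2 * exp (u j + u k))
    (1 + (sinh (d {i, j} / 2))\<^sup>2 * exp (u i + u j))
    (1 + (sinh (d {i, k} / 2))\<^sup>2 * exp (u i + u k))"
  using assms by (simp add: ext_angle_eq_half_angle vertex_scaling_pos cosh_square_vertex_scaling)

lemma ext_angle_monotone:
  fixes u v :: "nat \<Rightarrow> real"
  assumes dist: "i \<noteq> j" "i \<noteq> k" "j \<noteq> k" and d: "0 < d {i, j}" "0 < d {i, k}" "0 < d {j, k}"
  defines "\<delta> \<equiv> \<lambda>i j k. ext_angle (vertex_scaling u d) i j k - ext_angle (vertex_scaling v d) i j k"
  shows "(u i - v i) * \<delta> i j k + (u j - v j) * \<delta> j k i + (u k - v k) * \<delta> k i j \<le> 0"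
proof -
  \<comment> \<open>The edge data are taken at \<open>v\<close>, so that parameter 0 of the segment
    is \<open>v\<close> and parameter 1 is \<open>u\<close>.\<close>
  define P Q R where "P = (sinh (d {j, k} / 2))\<^sup>2 * exp (v j + v k)"
    and "Q = (sinh (d {i, k} / 2))\<^sup>2 * exp (v i + v k)"
    and "R = (sinh (d {i, j} / 2))\<^sup>2 * exp (v i + v j)"
  have pos: "0 < P" "0 < Q" "0 < R"
    using d by (auto simp: P_def Q_def R_def)
  have u: "(sinh (d {j, k} / 2))\<^sup>2 * exp (u j + u k) = P * exp ((u j - v j) + (u k - v k))"
    "(sinh (d {i, k} / 2))\<^sup>2 * exp (u i + u k) = Q * exp ((u i - v i) + (u k - v k))"
    "(sinh (d {i, j} / 2))\<^sup>2 * exp (u i + u j) = R * exp ((u i - v i) + (u j - v j))"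
    by (simp_all add: P_def Q_def R_def mult.assoc flip: exp_add)
  have s: "ext_angle (vertex_scaling w d) i j k = half_angle
      (1 + (sinh (d {j, k} / 2))\<^sup>2 * exp (w j + w k))
      (1 + (sinh (d {i, k} / 2))\<^sup>2 * exp (w i + w k))
      (1 + (sinh (d {i, j} / 2))\<^sup>2 * exp (w i + w j))"
    "ext_angle (vertex_scaling w d) j k i = half_angle
      (1 + (sinh (d {i, k} / 2))\<^sup>2 * exp (w i + w k))
      (1 + (sinh (d {j, k} / 2))\<^sup>2 * exp (w j + w k))
      (1 + (sinh (d {i, j} / 2))\<^sup>2 * exp (w i + w j))"
    "ext_angle (vertex_scaling w d) k i j = half_angle
      (1 + (sinh (d {i, j} / 2))\<^sup>2 * exp (w i + w j))
      (1 + (sinh (d {j, k} / 2))\<^sup>2 * exp (w j + w k))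
      (1 + (sinh (d {i, k} / 2))\<^sup>2 * exp (w i + w k))" for w
    using ext_angle_vertex_scaling[of i j k d w] ext_angle_vertex_scaling[of j k i d w]
      ext_angle_vertex_scaling[of k i j d w] dist d
    by (simp_all add: insert_commute half_angle_swap add.commute)
  show ?thesis
    using half_angle_scaling_monotone[OF pos, of "u i - v i" "u j - v j" "u k - v k"]
    unfolding \<delta>_def s[of u, unfolded u] s[of v, folded P_def Q_def R_def]
    by (simp add: algebra_simps)
qed

section \<open>Summation over the faces meeting a finite vertex set\<close>

text \<open>Interchanging the indices maps the pairs below the diagonal to those above it. This
  trades the ordered pairs used in the curvature for all pairs, as the cyclic argument
  requires.\<close>

lemma sum_symmetric_pairs:
  fixes h :: "'b::linorder \<Rightarrow> 'b \<Rightarrow> real"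
  assumes "\<And>j k. h j k = h k j" "\<And>j. h j j = 0"
  shows "2 * (\<Sum>j\<in>S. \<Sum>k\<in>S. if j < k then h j k else 0) = (\<Sum>j\<in>S. \<Sum>k\<in>S. h j k)"
proof -
  have "(\<Sum>j\<in>S. \<Sum>k\<in>S. if j < k then h j k else 0) = (\<Sum>j\<in>S. \<Sum>k\<in>S. if k < j then h j k else 0)"
    by (subst sum.swap) (simp add: assms(1) cong: if_cong)
  then have "2 * (\<Sum>j\<in>S. \<Sum>k\<in>S. if j < k then h j k else 0) =
    (\<Sum>j\<in>S. \<Sum>k\<in>S. (if j < k then h j k else 0) + (if k < j then h j k else 0))"
    by (simp add: sum.distrib)
  also have "\<dots> = (\<Sum>j\<in>S. \<Sum>k\<in>S. h j k)"
    by (intro sum.cong refl) (use assms(2) in \<open>auto simp: not_less dest: antisym\<close>)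
  finally show ?thesis .
qed

text \<open>Renaming the indices cyclically leaves the sum unchanged, so three copies of it add up
  the left-hand sides of the assumption.\<close>

lemma sum_cyclic_nonpos:
  fixes h :: "'b \<Rightarrow> 'b \<Rightarrow> 'b \<Rightarrow> real"
  assumes "\<And>i j k. h i j k + h j k i + h k i j \<le> 0"
  shows "(\<Sum>i\<in>S. \<Sum>j\<in>S. \<Sum>k\<in>S. h i j k) \<le> 0" (is "?X \<le> 0")
proof -
  have a: "?X = (\<Sum>i\<in>S. \<Sum>j\<in>S. \<Sum>k\<in>S. h j k i)"
  proof -
    have "(\<Sum>i\<in>S. \<Sum>j\<in>S. \<Sum>k\<in>S. h j k i) = (\<Sum>j\<in>S. \<Sum>i\<in>S. \<Sum>k\<in>S. h j k i)"
      by (rule sum.swap)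
    also have "\<dots> = ?X" by (rule sum.cong[OF refl], rule sum.swap)
    finally show ?thesis by simp
  qed
  have b: "?X = (\<Sum>i\<in>S. \<Sum>j\<in>S. \<Sum>k\<in>S. h k i j)"
  proof -
    have "(\<Sum>i\<in>S. \<Sum>j\<in>S. \<Sum>k\<in>S. h k i j) = (\<Sum>i\<in>S. \<Sum>k\<in>S. \<Sum>j\<in>S. h k i j)"
      by (rule sum.cong[OF refl], rule sum.swap)
    also have "\<dots> = ?X" by (rule sum.swap)
    finally show ?thesis by simp
  qed
  have "3 * ?X = (\<Sum>i\<in>S. \<Sum>j\<in>S. \<Sum>k\<in>S. h i j k + h j k i + h k i j)"
    using a b by (simp add: sum.distrib)
  also have "\<dots> \<le> 0" by (intro sum_nonpos assms)
  finally show ?thesis by simp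
qed

text \<open>The edges of the link of \<open>i\<close>, in the orientation of the index set of
  \<open>gen_curvature\<close>.\<close>

definition link_pairs :: "nat set set \<Rightarrow> nat \<Rightarrow> (nat \<times> nat) set" where
  "link_pairs F i = {(j, k). j < k \<and> {i, j, k} \<in> F}"

lemma gen_curvature_diff:
  "gen_curvature F d v i - gen_curvature F d u i =
    (\<Sum>(j, k)\<in>link_pairs F i.
      ext_angle (vertex_scaling u d) i j k - ext_angle (vertex_scaling v d) i j k)"
  by (simp add: gen_curvature_def link_pairs_def sum_subtractf case_prod_unfold)

text \<open>
  Faces inside \<open>S\<close> contribute a nonpositive amount by monotonicity, and each of the remaining
  incidences, all at vertices outside \<open>A\<close>, costs at most \<open>\<pi>\<close>.
\<close>

lemma sum_curvature_diff_le:
  fixes u v :: "nat \<Rightarrow> real"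
  assumes dist: "\<And>i j k. {i, j, k} \<in> F \<Longrightarrow> i \<noteq> j \<and> i \<noteq> k \<and> j \<noteq> k"
    and pos: "\<And>i j k. {i, j, k} \<in> F \<Longrightarrow> 0 < d {i, j}"
    and "finite S" "A \<subseteq> S"
    and fin: "\<And>i. i \<in> S \<Longrightarrow> finite (link_pairs F i) \<and> card (link_pairs F i) \<le> N"
    and A: "\<And>i. i \<in> A \<Longrightarrow> link_pairs F i \<subseteq> S \<times> S"
  shows "(\<Sum>i\<in>S. (u i - v i) * (gen_curvature F d v i - gen_curvature F d u i))
    \<le> N * pi * (\<Sum>i\<in>S - A. \<bar>u i - v i\<bar>)"
proof -
  define \<delta> where "\<delta> i j k = ext_angle (vertex_scaling u d) i j k - ext_angle (vertex_scaling v d) i j k" for i j k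
  \<comment> \<open>Extension by zero off the faces lets the sum run over all triples of
    \<open>S\<close>.\<close>
  define h where "h i j k = (if {i, j, k} \<in> F then (u i - v i) * \<delta> i j k else 0)" for i j k
  have pos': "0 < d {i, j}" "0 < d {i, k}" "0 < d {j, k}" if "{i, j, k} \<in> F" for i j k
    using that pos[of i j k] pos[of i k j] pos[of j k i] by (simp_all add: insert_commute)
  have vpos: "0 < vertex_scaling w d {i, j}" "0 < vertex_scaling w d {i, k}" "0 < vertex_scaling w d {j, k}"
    if "{i, j, k} \<in> F" for i j k w
    using dist[OF that] pos'[OF that] by (simp_all add: vertex_scaling_pos)
  have \<delta>_le: "\<bar>\<delta> i j k\<bar> \<le> pi" if "{i, j, k} \<in> F" for i j k
    using ext_angle_bounds[OF vpos[OF that, of u]] ext_angle_bounds[OF vpos[OF that, of v]]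
    by (auto simp: \<delta>_def)
  have h_sym: "h i j k = h i k j" for i j k
  proof (cases "{i, j, k} \<in> F")
    case True
    then show ?thesis
      using ext_angle_swap[OF vpos[OF True]] by (simp add: h_def \<delta>_def insert_commute)
  qed (simp add: h_def insert_commute)
  have h_diag: "h i j j = 0" for i j
    using dist[of i j j] by (auto simp: h_def)
  have h_cyc: "h i j k + h j k i + h k i j \<le> 0" for i j k
  proof (cases "{i, j, k} \<in> F")
    case True
    then have "{j, k, i} \<in> F" "{k, i, j} \<in> F" by (simp_all add: insert_commute)
    with True show ?thesis
      using ext_angle_monotone[of i j k d u v] dist[OF True] pos'[OF True]
      by (simp add: h_def \<delta>_def)
  next
    case False
    then have "{j, k, i} \<notin> F" "{k, i, j} \<notin> F" by (simp_all add: insert_commute)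
    with False show ?thesis by (simp add: h_def)
  qed
  \<comment> \<open>The angles at \<open>i\<close> are split according to whether the opposite edge
    has both ends in \<open>S\<close>.\<close>
  let ?in = "\<lambda>i. \<Sum>(j, k)\<in>link_pairs F i \<inter> S \<times> S. \<delta> i j k"
  let ?out = "\<lambda>i. \<Sum>(j, k)\<in>link_pairs F i - S \<times> S. \<delta> i j k"
  have split: "gen_curvature F d v i - gen_curvature F d u i = ?in i + ?out i" if "i \<in> S" for i
    unfolding gen_curvature_diff \<delta>_def[symmetric]
    using sum.Int_Diff[of "link_pairs F i"] fin[OF that] by blast
  have in_eq: "(u i - v i) * ?in i = (\<Sum>j\<in>S. \<Sum>k\<in>S. if j < k then h i j k else 0)" for i
  proof -
    have "(\<Sum>j\<in>S. \<Sum>k\<in>S. if j < k then h i j k else 0) =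
        (\<Sum>(j, k)\<in>S \<times> S. if (j, k) \<in> link_pairs F i then (u i - v i) * \<delta> i j k else 0)"
      by (auto simp: sum.cartesian_product link_pairs_def h_def intro!: sum.cong)
    also have "\<dots> = (\<Sum>p\<in>S \<times> S. if p \<in> link_pairs F i then (u i - v i) * (case p of (j, k) \<Rightarrow> \<delta> i j k) else 0)"
      by (intro sum.cong) auto
    also have "\<dots> = (\<Sum>p\<in>S \<times> S \<inter> link_pairs F i. (u i - v i) * (case p of (j, k) \<Rightarrow> \<delta> i j k))"
      using \<open>finite S\<close> by (intro sum.inter_restrict[symmetric]) simp
    finally show ?thesis
      by (simp add: sum_distrib_left Int_commute)
  qed
  have "2 * (\<Sum>i\<in>S. (u i - v i) * ?in i) = (\<Sum>i\<in>S. 2 * (\<Sum>j\<in>S. \<Sum>k\<in>S. if j < k then h i j k else 0))"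
    unfolding in_eq by (rule sum_distrib_left)
  also have "\<dots> = (\<Sum>i\<in>S. \<Sum>j\<in>S. \<Sum>k\<in>S. h i j k)"
    by (rule sum.cong[OF refl], rule sum_symmetric_pairs) (rule h_sym h_diag)+
  also have "\<dots> \<le> 0" by (rule sum_cyclic_nonpos) (rule h_cyc)
  finally have inner: "(\<Sum>i\<in>S. (u i - v i) * ?in i) \<le> 0" by simp
  have out: "\<bar>?out i\<bar> \<le> N * pi" if "i \<in> S" for i
  proof -
    have "\<bar>?out i\<bar> \<le> (\<Sum>p\<in>link_pairs F i - S \<times> S. \<bar>case p of (j, k) \<Rightarrow> \<delta> i j k\<bar>)"
      by (rule sum_abs)
    also have "\<dots> \<le> (\<Sum>p\<in>link_pairs F i - S \<times> S. pi)"
      by (intro sum_mono) (auto simp: link_pairs_def intro: \<delta>_le)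
    also have "\<dots> = card (link_pairs F i - S \<times> S) * pi" by simp
    also have "\<dots> \<le> N * pi"
      using fin[OF that] by (intro mult_right_mono) (auto intro: order.trans[OF card_mono])
    finally show ?thesis .
  qed
  \<comment> \<open>At a vertex of \<open>A\<close> the whole link lies in \<open>S\<close>, so
    \<open>?out\<close> is an empty sum.\<close>
  have "(\<Sum>i\<in>S. (u i - v i) * ?out i) = (\<Sum>i\<in>S - A. (u i - v i) * ?out i)"
    using \<open>finite S\<close> \<open>A \<subseteq> S\<close> A by (intro sum.mono_neutral_right) (auto simp: Diff_eq_empty_iff[THEN iffD2])
  also have "\<dots> \<le> (\<Sum>i\<in>S - A. \<bar>u i - v i\<bar> * (N * pi))"
  proof (rule sum_mono)
    fix i assume "i \<in> S - A"
    have "(u i - v i) * ?out i \<le> \<bar>u i - v i\<bar> * \<bar>?out i\<bar>"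
      by (metis abs_ge_self abs_mult)
    also have "\<dots> \<le> \<bar>u i - v i\<bar> * (N * pi)"
      using out \<open>i \<in> S - A\<close> by (intro mult_left_mono) auto
    finally show "(u i - v i) * ?out i \<le> \<bar>u i - v i\<bar> * (N * pi)" .
  qed
  finally have outer: "(\<Sum>i\<in>S. (u i - v i) * ?out i) \<le> N * pi * (\<Sum>i\<in>S - A. \<bar>u i - v i\<bar>)"
    by (simp add: sum_distrib_left mult.commute)
  have "(\<Sum>i\<in>S. (u i - v i) * (gen_curvature F d v i - gen_curvature F d u i)) =
      (\<Sum>i\<in>S. (u i - v i) * ?in i) + (\<Sum>i\<in>S. (u i - v i) * ?out i)"
    by (simp add: split distrib_left sum.distrib)
  then show ?thesis using inner outer by linarith
qed

section \<open>Local combinatorics of the triangulation\<close>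

lemma face_edges:
  assumes "infinitely_triangulated_surface M V E F" "{i, j, k} \<in> F"
  shows "i \<noteq> j \<and> i \<noteq> k \<and> j \<noteq> k" "{i, j} \<in> E" "{i, k} \<in> E" "{i, j, k} \<subseteq> V"
proof -
  have "\<forall>f\<in>F. f \<subseteq> V \<and> card f = 3" "\<forall>f\<in>F. \<forall>e. e \<subseteq> f \<and> card e = 2 \<longrightarrow> e \<in> E"
    using assms(1) by (simp_all add: infinitely_triangulated_surface_def)
  from this[THEN bspec, OF assms(2)]
  have card: "card {i, j, k} = 3" and V: "{i, j, k} \<subseteq> V"
    and E: "\<And>e. e \<subseteq> {i, j, k} \<Longrightarrow> card e = 2 \<Longrightarrow> e \<in> E"
    by simp_all
  from card show dist: "i \<noteq> j \<and> i \<noteq> k \<and> j \<noteq> k"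
    by (simp add: card_insert_if split: if_splits)
  show "{i, j} \<in> E" "{i, k} \<in> E" using dist by (simp_all add: E)
  show "{i, j, k} \<subseteq> V" by (rule V)
qed

text \<open>A link pair consists of two neighbours of \<open>i\<close>, and distinct neighbours give
  distinct edges at \<open>i\<close>. The crude square already yields a bound that is uniform for
  bounded degree.\<close>

lemma card_link_pairs_le:
  assumes M: "infinitely_triangulated_surface M V E F" and "i \<in> V"
  shows "finite (link_pairs F i)" "card (link_pairs F i) \<le> (vertex_degree E i)\<^sup>2"
proof -
  define N where "N = {j. {i, j} \<in> E}"
  have inj: "inj_on (\<lambda>j. {i, j}) N"
    by (auto simp: inj_on_def doubleton_eq_iff)
  have "finite {s \<in> E \<union> F. i \<in> s}"
    using assms by (auto simp: infinitely_triangulated_surface_def)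
  then have fin: "finite {e \<in> E. i \<in> e}" by (rule rev_finite_subset) auto
  have sub: "(\<lambda>j. {i, j}) ` N \<subseteq> {e \<in> E. i \<in> e}" by (auto simp: N_def)
  have N: "finite N" "card N \<le> vertex_degree E i"
    using inj_on_finite[OF inj sub fin] card_inj_on_le[OF inj sub fin]
    by (simp_all add: vertex_degree_def)
  have L: "link_pairs F i \<subseteq> N \<times> N"
    using face_edges[OF M] by (auto simp: link_pairs_def N_def)
  show "finite (link_pairs F i)" using L N(1) by (meson finite_SigmaI finite_subset)
  have "card (link_pairs F i) \<le> card N * card N"
    using card_mono[OF _ L] N(1) by (simp add: card_cartesian_product)
  also have "\<dots> \<le> (vertex_degree E i)\<^sup>2"
    using N(2) by (simp add: power2_eq_square mult_mono)
  finally show "card (link_pairs F i) \<le> (vertex_degree E i)\<^sup>2" .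
qed

section \<open>Time integrals and the energy estimate\<close>

lemma integral_nonneg_always:
  fixes f :: "real \<Rightarrow> real"
  assumes "\<And>x. 0 \<le> f x"
  shows "0 \<le> integral S f"
  \<comment> \<open>The integral of a nonintegrable function is 0 by convention.\<close>
  by (cases "f integrable_on S") (auto intro!: integral_nonneg assms simp: not_integrable_integral)

text \<open>Connects the Lebesgue integral in \<open>L1_l1\<close> with the gauge integral whose
  upper limit is differentiated in the energy estimate.\<close>

lemma nn_integral_abs_continuous:
  fixes f :: "real \<Rightarrow> real"
  assumes "continuous_on {0..T} f" "0 \<le> T"
  shows "(\<integral>\<^sup>+ t. ennreal \<bar>f t\<bar> \<partial>lebesgue_on {0..<T}) = ennreal (integral {0..T} (\<lambda>t. \<bar>f t\<bar>))"
proof -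
  have "(\<lambda>t. \<bar>f t\<bar>) integrable_on {0..T}"
    using assms by (intro integrable_continuous_interval continuous_intros)
  then have "((\<lambda>t. \<bar>f t\<bar>) has_integral integral {0..T} (\<lambda>t. \<bar>f t\<bar>)) {0..T}"
    by (rule integrable_integral)
  \<comment> \<open>The half-open and the closed interval differ by the null set
    \<open>{T}\<close>.\<close>
  moreover have "((\<lambda>t. \<bar>f t\<bar>) has_integral I) {0..T} \<longleftrightarrow> ((\<lambda>t. \<bar>f t\<bar>) has_integral I) {0..<T}" for I
    by (rule has_integral_spike_set_eq; rule negligible_subset[of "{T}"]) auto
  ultimately have "((\<lambda>t. \<bar>f t\<bar>) has_integral integral {0..T} (\<lambda>t. \<bar>f t\<bar>)) {0..<T}" by simp
  from nn_integral_has_integral_lebesgue'[OF _ this]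
  show ?thesis
    by (simp add: nn_integral_restrict_space nn_integral_completion)
qed

text \<open>The finite sum is moved inside the time integral, where it is dominated pointwise by the
  \<open>l\<^sup>1\<close> norm.\<close>

lemma sum_integral_le_nn_integral:
  fixes w :: "real \<Rightarrow> nat \<Rightarrow> real"
  assumes "finite B" "B \<subseteq> V" "0 \<le> T"
    and cont: "\<And>i. i \<in> V \<Longrightarrow> continuous_on {0..T} (\<lambda>t. w t i)"
  shows "ennreal (\<Sum>i\<in>B. integral {0..T} (\<lambda>t. \<bar>w t i\<bar>)) \<le>
    (\<integral>\<^sup>+ t. (\<integral>\<^sup>+ i. ennreal \<bar>w t i\<bar> \<partial>count_space V) \<partial>lebesgue_on {0..<T})"
proof -
  have int: "0 \<le> integral {0..T} (\<lambda>t. \<bar>w t i\<bar>)" for i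
    by (rule integral_nonneg_always) auto
  have meas: "(\<lambda>t. ennreal \<bar>w t i\<bar>) \<in> borel_measurable (lebesgue_on {0..<T})" if "i \<in> B" for i
  proof -
    have "continuous_on {0..<T} (\<lambda>t. w t i)"
      using assms(2) that by (intro continuous_on_subset[OF cont]) auto
    then have [measurable]: "(\<lambda>t. w t i) \<in> borel_measurable (lebesgue_on {0..<T})"
      by (intro continuous_imp_measurable_on_sets_lebesgue) auto
    show ?thesis by measurable
  qed
  have "ennreal (\<Sum>i\<in>B. integral {0..T} (\<lambda>t. \<bar>w t i\<bar>)) =
      (\<Sum>i\<in>B. ennreal (integral {0..T} (\<lambda>t. \<bar>w t i\<bar>)))"
    by (rule sum_ennreal[symmetric]) (rule int)
  also have "\<dots> = (\<Sum>i\<in>B. \<integral>\<^sup>+ t. ennreal \<bar>w t i\<bar> \<partial>lebesgue_on {0..<T})"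
    by (rule sum.cong[OF refl], rule nn_integral_abs_continuous[symmetric])
      (use assms(2,3) cont in auto)
  also have "\<dots> = (\<integral>\<^sup>+ t. (\<Sum>i\<in>B. ennreal \<bar>w t i\<bar>) \<partial>lebesgue_on {0..<T})"
    by (rule nn_integral_sum[symmetric]) (rule meas)
  also have "\<dots> \<le> (\<integral>\<^sup>+ t. (\<integral>\<^sup>+ i. ennreal \<bar>w t i\<bar> \<partial>count_space V) \<partial>lebesgue_on {0..<T})"
  proof (rule nn_integral_mono)
    fix t
    have "(\<Sum>i\<in>B. ennreal \<bar>w t i\<bar>) = (\<integral>\<^sup>+ i. ennreal \<bar>w t i\<bar> * indicator B i \<partial>count_space V)"
      using nn_integral_count_space'[OF assms(1) _ assms(2), of "\<lambda>i. ennreal \<bar>w t i\<bar> * indicator B i"]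
      by simp
    also have "\<dots> \<le> (\<integral>\<^sup>+ i. ennreal \<bar>w t i\<bar> \<partial>count_space V)"
      by (intro nn_integral_mono) (auto split: split_indicator)
    finally show "(\<Sum>i\<in>B. ennreal \<bar>w t i\<bar>) \<le> (\<integral>\<^sup>+ i. ennreal \<bar>w t i\<bar> \<partial>count_space V)" .
  qed
  finally show ?thesis .
qed

text \<open>Choose \<open>A\<close> with sum within \<open>e\<close> of the supremum over finite
  sets; a finite set disjoint from \<open>A\<close> can then add at most \<open>e\<close>.\<close>

lemma bounded_finite_sums_tail:
  fixes a :: "'b \<Rightarrow> real"
  assumes bound: "\<And>B. finite B \<Longrightarrow> B \<subseteq> V \<Longrightarrow> sum a B \<le> K" and "0 < e"
  shows "\<exists>A. finite A \<and> A \<subseteq> V \<and> (\<forall>B. finite B \<and> B \<subseteq> V - A \<longrightarrow> sum a B \<le> e)"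
proof -
  let ?\<A> = "{A. finite A \<and> A \<subseteq> V}"
  have "{} \<in> ?\<A>" by simp
  then have ne: "?\<A> \<noteq> {}" by (metis empty_iff)
  have bdd: "bdd_above (sum a ` ?\<A>)"
    by (rule bdd_aboveI2[of _ _ K]) (simp add: bound)
  have "(SUP A\<in>?\<A>. sum a A) - e < (SUP A\<in>?\<A>. sum a A)" using \<open>0 < e\<close> by simp
  then have "\<exists>A\<in>?\<A>. (SUP A\<in>?\<A>. sum a A) - e < sum a A"
    by (simp only: less_cSUP_iff[OF ne bdd])
  then obtain A where A: "A \<in> ?\<A>" "(SUP A\<in>?\<A>. sum a A) - e < sum a A"
    by (rule bexE)
  have "sum a B \<le> e" if B: "finite B" "B \<subseteq> V - A" for B
  proof -
    from B have "A \<union> B \<in> ?\<A>" using A(1) by auto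
    then have "sum a (A \<union> B) \<le> (SUP A\<in>?\<A>. sum a A)" by (rule cSUP_upper[OF _ bdd])
    moreover have "sum a (A \<union> B) = sum a A + sum a B"
      using A(1) B by (intro sum.union_disjoint) auto
    ultimately show ?thesis using A(2) by linarith
  qed
  with A(1) show ?thesis by blast
qed

text \<open>The energy minus the accumulated bound, \<open>\<Psi>\<close>, has nonpositive
  derivative and vanishes at time 0.\<close>

lemma energy_estimate:
  fixes w w' :: "real \<Rightarrow> 'b \<Rightarrow> real"
  assumes "finite S" "B \<subseteq> S" "0 \<le> T"
    and der: "\<And>i t. i \<in> S \<Longrightarrow> 0 \<le> t \<Longrightarrow> ((\<lambda>s. w s i) has_real_derivative w' t i) (at t within {0..})"
    and init: "\<And>i. i \<in> S \<Longrightarrow> w 0 i = 0"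
    and le: "\<And>t. 0 \<le> t \<Longrightarrow> (\<Sum>i\<in>S. w t i * w' t i) \<le> C * (\<Sum>i\<in>B. \<bar>w t i\<bar>)"
  shows "(\<Sum>i\<in>S. (w T i)\<^sup>2) \<le> 2 * C * (\<Sum>i\<in>B. integral {0..T} (\<lambda>t. \<bar>w t i\<bar>))"
proof -
  have der': "((\<lambda>s. w s i) has_real_derivative w' t i) (at t within {0..T})" if "i \<in> S" "t \<in> {0..T}" for i t
    using der[of i t] that by (auto intro: has_field_derivative_subset)
  have cont: "continuous_on {0..T} (\<lambda>t. w t i)" if "i \<in> S" for i
    using der'[OF that] by (intro DERIV_continuous_on)
  define \<Psi> where "\<Psi> t = (\<Sum>i\<in>S. (w t i)\<^sup>2) - 2 * C * (\<Sum>i\<in>B. integral {0..t} (\<lambda>t. \<bar>w t i\<bar>))" for t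
  have dI: "((\<lambda>x. integral {0..x} (\<lambda>t. \<bar>w t i\<bar>)) has_real_derivative \<bar>w t i\<bar>) (at t within {0..T})"
    if "i \<in> B" "t \<in> {0..T}" for i t
    using that assms(2) by (intro integral_has_real_derivative continuous_intros cont) auto
  have dPsi: "(\<Psi> has_real_derivative 2 * (\<Sum>i\<in>S. w t i * w' t i) - 2 * C * (\<Sum>i\<in>B. \<bar>w t i\<bar>)) (at t within {0..T})"
    if "t \<in> {0..T}" for t
    unfolding \<Psi>_def[abs_def]
    by (rule derivative_eq_intros der' dI that refl | assumption)+ (simp add: sum_distrib_left mult_ac)
  have "\<Psi> T \<le> \<Psi> 0"
  proof (rule DERIV_nonpos_imp_decreasing_open[where f = \<Psi>])
    show "continuous_on {0..T} \<Psi>" using dPsi by (rule DERIV_continuous_on)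
    fix t assume t: "0 < t" "t < T"
    then have "(\<Psi> has_real_derivative 2 * (\<Sum>i\<in>S. w t i * w' t i) - 2 * C * (\<Sum>i\<in>B. \<bar>w t i\<bar>)) (at t)"
      using dPsi[of t] by (simp add: at_within_Icc_at)
    moreover have "2 * (\<Sum>i\<in>S. w t i * w' t i) - 2 * C * (\<Sum>i\<in>B. \<bar>w t i\<bar>) \<le> 0"
      using le[of t] t by (simp add: mult.assoc)
    ultimately show "\<exists>y. (\<Psi> has_real_derivative y) (at t) \<and> y \<le> 0" by blast
  qed (rule \<open>0 \<le> T\<close>)
  then show ?thesis using init by (simp add: \<Psi>_def)
qed

section \<open>Uniqueness by exhausting the vertex set\<close>

theorem theorem1p7:
  fixes M :: "'a topology"
    and V :: "nat set" and E F :: "nat set set"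
    and d\<^sub>0 :: "nat set \<Rightarrow> real"
    and D :: nat
    and u v :: "real \<Rightarrow> nat \<Rightarrow> real"
  assumes "infinitely_triangulated_surface M V E F"
    and "PH_metric E F d\<^sub>0"
    and "\<forall>i\<in>V. vertex_degree E i \<le> D"
    and "extended_Yamabe_flow V F d\<^sub>0 u"
    and "extended_Yamabe_flow V F d\<^sub>0 v"
    and "\<forall>i\<in>V. u 0 i = v 0 i"
    and "\<forall>T>0. L1_l1 V T (\<lambda>t i. u t i - v t i)"
  shows "\<forall>t\<ge>0. \<forall>i\<in>V. u t i = v t i"
proof (intro allI impI ballI)
  fix T :: real and i0
  assume T: "0 \<le> T" and i0: "i0 \<in> V"
  note surf = assms(1)
  define w where "w t i = u t i - v t i" for t i
  define w' where "w' t i = gen_curvature F d\<^sub>0 (v t) i - gen_curvature F d\<^sub>0 (u t) i" for t i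
  have flow: "((\<lambda>s. x s i) has_real_derivative - gen_curvature F d\<^sub>0 (x t) i) (at t within {0..})"
    if "extended_Yamabe_flow V F d\<^sub>0 x" "i \<in> V" "0 \<le> t" for x i t
    using that unfolding extended_Yamabe_flow_def by metis
  have dw: "((\<lambda>s. w s i) has_real_derivative w' t i) (at t within {0..})" if "i \<in> V" "0 \<le> t" for i t
    unfolding w_def w'_def
    using DERIV_diff[OF flow[OF assms(4) that] flow[OF assms(5) that]] by simp
  show "u T i0 = v T i0"
  \<comment> \<open>Integrability is assumed for positive \<open>T\<close>; time 0 is the initial
    condition.\<close>
  proof (cases "T = 0")
    case True
    then show ?thesis using assms(6) i0 by simp
  next
    case False
    with T have "0 < T" by simp
    define a where "a i = integral {0..T} (\<lambda>t. \<bar>w t i\<bar>)" for i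
    have cont: "continuous_on {0..T} (\<lambda>t. w t i)" if "i \<in> V" for i
      by (rule DERIV_continuous_on[where D = "\<lambda>t. w' t i"])
        (rule has_field_derivative_subset[OF dw[OF that]], auto)
    have "(\<integral>\<^sup>+ t. (\<integral>\<^sup>+ i. ennreal \<bar>w t i\<bar> \<partial>count_space V) \<partial>lebesgue_on {0..<T}) < \<infinity>"
      using assms(7) \<open>0 < T\<close> by (simp add: L1_l1_def w_def)
    then obtain K where K: "0 \<le> K"
      "(\<integral>\<^sup>+ t. (\<integral>\<^sup>+ i. ennreal \<bar>w t i\<bar> \<partial>count_space V) \<partial>lebesgue_on {0..<T}) = ennreal K"
      by (metis ennreal_cases infinity_ennreal_def less_irrefl)
    have bound: "sum a B \<le> K" if "finite B" "B \<subseteq> V" for B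
      using sum_integral_le_nn_integral[where w = w, OF that T cont] K by (simp add: a_def)
    \<comment> \<open>The 2 comes from differentiating squares, \<open>D\<^sup>2\<close> bounds the
      link pairs at a vertex, and \<open>pi\<close> bounds each angle difference.\<close>
    define C where "C = 2 * (real (D\<^sup>2) * pi)"
    have C: "0 \<le> C" by (simp add: C_def)
    have est: "(w T i0)\<^sup>2 \<le> C * e" if e: "0 < e" for e
    proof -
      obtain A where "finite A \<and> A \<subseteq> V \<and> (\<forall>B. finite B \<and> B \<subseteq> V - A \<longrightarrow> sum a B \<le> e)"
        using bounded_finite_sums_tail[OF bound e] by (rule exE)
      then have A: "finite A" "A \<subseteq> V" "\<And>B. finite B \<Longrightarrow> B \<subseteq> V - A \<Longrightarrow> sum a B \<le> e"
        by simp_all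
      \<comment> \<open>Including \<open>i0\<close> makes its energy part of the sum; removing
        \<open>A'\<close> from \<open>S\<close> still removes \<open>A\<close>, so the tail bound
        applies.\<close>
      define A' where "A' = insert i0 A"
      have A': "finite A'" "A' \<subseteq> V" using A i0 by (auto simp: A'_def)
      \<comment> \<open>Adding the endpoints of all link edges confines the boundary terms to
        \<open>S - A'\<close>.\<close>
      define S where "S = A' \<union> (\<Union>i\<in>A'. fst ` link_pairs F i \<union> snd ` link_pairs F i)"
      have S: "finite S" "A' \<subseteq> S"
        using A' card_link_pairs_le(1)[OF surf] by (auto simp: S_def)
      have SV: "S \<subseteq> V"
        using A' face_edges(4)[OF surf] by (auto simp: S_def link_pairs_def)
      have "(\<Sum>i\<in>S. (w T i)\<^sup>2) \<le> 2 * (real (D\<^sup>2) * pi) * (\<Sum>i\<in>S - A'. integral {0..T} (\<lambda>t. \<bar>w t i\<bar>))"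
      proof (rule energy_estimate[where w' = w'])
        fix t :: real
        show "(\<Sum>i\<in>S. w t i * w' t i) \<le> real (D\<^sup>2) * pi * (\<Sum>i\<in>S - A'. \<bar>w t i\<bar>)"
          unfolding w_def w'_def
        proof (rule sum_curvature_diff_le)
          show "0 < d\<^sub>0 {i, j}" if "{i, j, k} \<in> F" for i j k
            using assms(2) face_edges(2)[OF surf that] by (simp add: PH_metric_def)
          show "finite (link_pairs F i) \<and> card (link_pairs F i) \<le> D\<^sup>2" if "i \<in> S" for i
            using card_link_pairs_le[OF surf, of i] assms(3) SV that
            by (meson order.trans power_mono subsetD zero_le)
          show "link_pairs F i \<subseteq> S \<times> S" if "i \<in> A'" for i
            using that by (force simp: S_def)
        qed (use S face_edges(1)[OF surf] in auto)
      qed (use S SV T dw assms(6) in \<open>auto simp: w_def\<close>)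
      also have "\<dots> \<le> C * e"
        unfolding C_def[symmetric] a_def[symmetric] using S SV C
        by (intro mult_left_mono A) (auto simp: A'_def)
      finally have "(\<Sum>i\<in>S. (w T i)\<^sup>2) \<le> C * e" .
      moreover have "(w T i0)\<^sup>2 \<le> (\<Sum>i\<in>S. (w T i)\<^sup>2)"
        using S by (intro member_le_sum) (auto simp: A'_def)
      ultimately show ?thesis by linarith
    qed
    have "(w T i0)\<^sup>2 \<le> 0"
    proof (rule field_le_epsilon)
      fix e :: real assume "0 < e"
      \<comment> \<open>Dividing by \<open>C + 1\<close> avoids a separate case for
        \<open>C = 0\<close>.\<close>
      have "(w T i0)\<^sup>2 \<le> C * (e / (C + 1))" using C \<open>0 < e\<close> by (intro est) auto
      also have "\<dots> \<le> 0 + e" using C \<open>0 < e\<close> by (simp add: field_simps)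
      finally show "(w T i0)\<^sup>2 \<le> 0 + e" .
    qed
    then show ?thesis by (simp add: w_def)
  qed
qed

end
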